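(* Let $F$ be a field of characteristic zero, let $\delta\in F$ with $\delta\neq 1$, and let $(N,\cdot)$ be a $\delta$-Novikov algebra over $F$. Then $N$ with the commutator product $[a,b]=a\cdot b-b\cdot a$ is a metabelian Lie algebra; that is, $(N,[\cdot,\cdot])$ is a Lie algebra satisfying $[[x,y],[z,t]]=0$ for all $x,y,z,t\in N$.
   Context: A (left) $\delta$-Novikov algebra is a (not necessarily associative) algebra satisfying, for all $x,y,z$, $\delta(xy)z-x(yz)=\delta(yx)z-y(xz)$ and $(xy)z=(xz)y$. *)

theory Defs
  imports Complex_Main
begin

locale nonassoc_algebra = vector_space scale
  for scale :: "'f::field \<Rightarrow> 'n::ab_group_add \<Rightarrow> 'n" (infixr \<open>*s\<close> 75) +
  fixes mul :: "'n \<Rightarrow> 'n \<Rightarrow> 'n" (infixl \<open>\<odot>\<close> 70)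
  assumes mul_linear_left: "Vector_Spaces.linear scale scale (\<lambda>x. x \<odot> y)"
    and mul_linear_right: "Vector_Spaces.linear scale scale (\<lambda>y. x \<odot> y)"

locale delta_novikov_algebra = nonassoc_algebra scale mul
  for scale :: "'f::field \<Rightarrow> 'n::ab_group_add \<Rightarrow> 'n" (infixr \<open>*s\<close> 75)
    and mul :: "'n \<Rightarrow> 'n \<Rightarrow> 'n" (infixl \<open>\<odot>\<close> 70)
    and \<delta> :: 'f +
  assumes delta_left_symmetric:
      "\<delta> *s ((x \<odot> y) \<odot> z) - x \<odot> (y \<odot> z) = \<delta> *s ((y \<odot> x) \<odot> z) - y \<odot> (x \<odot> z)"
    and right_commutative: "(x \<odot> y) \<odot> z = (x \<odot> z) \<odot> y"

locale lie_algebra = nonassoc_algebra scale br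
  for scale :: "'f::field \<Rightarrow> 'n::ab_group_add \<Rightarrow> 'n"
    and br :: "'n \<Rightarrow> 'n \<Rightarrow> 'n" +
  assumes alternating: "br x x = 0"
    and jacobi: "br (br x y) z + br (br y z) x + br (br z x) y = 0"

locale metabelian_lie_algebra = lie_algebra scale br
  for scale :: "'f::field \<Rightarrow> 'n::ab_group_add \<Rightarrow> 'n"
    and br :: "'n \<Rightarrow> 'n \<Rightarrow> 'n" +
  assumes metabelian: "br (br x y) (br z t) = 0"

definition commutator :: "('n::ab_group_add \<Rightarrow> 'n \<Rightarrow> 'n) \<Rightarrow> 'n \<Rightarrow> 'n \<Rightarrow> 'n" where
  "commutator mul a b = mul a b - mul b a"

end

theory Submission
  imports Defs
begin

text \<open>
  Write \<open>[a,b]\<close> for the commutator.  The first axiom says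
  \<open>x(yz) - y(xz) = \<delta> [x,y]z\<close>, and the second that right multiplications commute.

  Jacobi: the cyclic sum of \<open>[x,y]z\<close> vanishes by right commutativity, and the cyclic sum of
  \<open>z[x,y]\<close> is, after regrouping, the cyclic sum of \<open>x(yz) - y(xz)\<close>, hence \<open>\<delta>\<close> times the former.

  Metabelian: consider products of shape \<open>(xy)(zt)\<close>.
  Right commutativity turns \<open>(xy)(zt)\<close> into \<open>(x(zt))y\<close>, so the first axiom can be applied inside
  the left factor; the result is that exchanging the two left entries \<open>x, z\<close> changes the product
  by \<open>\<delta> (w x - w z)\<close>, where \<open>w x = ((xy)z)t\<close> depends only on which of the four entries comes first
  (\<open>swap_left_entries\<close>).  Let \<open>D x z\<close> be the change of \<open>(xy)(zt)\<close> when the two right entries \<open>y, t\<close>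
  are exchanged.  As \<open>w x - w z\<close> is symmetric in \<open>y, t\<close>, it follows that \<open>D x z = D z x\<close>.  The first
  axiom applied to \<open>xy\<close>, \<open>z\<close>, \<open>t\<close> gives on the other hand \<open>D x z = \<delta> D z x\<close>
  (\<open>swap_right_entries_twisted\<close>), so \<open>D = 0\<close> if \<open>\<delta> \<noteq> 1\<close>: the right entries may be
  exchanged freely.  Then \<open>(xy)(zt) - (zt)(xy)\<close> is just an exchange of left entries and equals
  \<open>\<delta> (w x - w z)\<close>.  Expanding \<open>[[x,y],[z,t]]\<close> into four such differences, all terms cancel:
  \<open>(w x - w z) - (w y - w z) - (w x - w t) + (w y - w t) = 0\<close>.
\<close>

context nonassoc_algebra
begin

lemma mul_diff_left: "(a - b) \<odot> c = a \<odot> c - b \<odot> c"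
  using module_hom.diff[OF module_hom_linearI[OF mul_linear_left]] .

lemma mul_diff_right: "a \<odot> (b - c) = a \<odot> b - a \<odot> c"
  using module_hom.diff[OF module_hom_linearI[OF mul_linear_right]] .

lemma mul_scale_left: "(r *s a) \<odot> b = r *s (a \<odot> b)"
  using module_hom.scale[OF module_hom_linearI[OF mul_linear_left]] .

lemma nonassoc_algebra_commutator: "nonassoc_algebra scale (commutator mul)"
proof -
  interpret endo: vector_space_pair scale scale
    by unfold_locales
  note linear_sub = endo.module_hom_sub[unfolded module_hom_iff_linear]
  show ?thesis
  proof (intro nonassoc_algebra.intro nonassoc_algebra_axioms.intro)
    show "vector_space scale" ..
    show "Vector_Spaces.linear scale scale (\<lambda>x. commutator mul x y)" for y
      unfolding commutator_def by (intro linear_sub mul_linear_left mul_linear_right)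
    show "Vector_Spaces.linear scale scale (\<lambda>y. commutator mul x y)" for x
      unfolding commutator_def by (intro linear_sub mul_linear_left mul_linear_right)
  qed
qed

end

context delta_novikov_algebra
begin

lemma left_mul_commutator:
  "x \<odot> (y \<odot> z) - y \<odot> (x \<odot> z) = \<delta> *s ((x \<odot> y) \<odot> z) - \<delta> *s ((y \<odot> x) \<odot> z)"
  using delta_left_symmetric[of x y z] by (simp add: algebra_simps)

lemma commutator_jacobi:
  fixes x y z :: 'n
  defines "br \<equiv> commutator mul"
  shows "br (br x y) z + br (br y z) x + br (br z x) y = 0"
proof -
  have right: "(x \<odot> y) \<odot> z = (x \<odot> z) \<odot> y" "(y \<odot> z) \<odot> x = (y \<odot> x) \<odot> z"
    "(z \<odot> x) \<odot> y = (z \<odot> y) \<odot> x"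
    by (rule right_commutative)+
  have left: "(x \<odot> (y \<odot> z) - y \<odot> (x \<odot> z)) + (y \<odot> (z \<odot> x) - z \<odot> (y \<odot> x))
      + (z \<odot> (x \<odot> y) - x \<odot> (z \<odot> y)) = 0"
    unfolding left_mul_commutator right by simp
  have "br (br x y) z + br (br y z) x + br (br z x) y =
      - ((x \<odot> (y \<odot> z) - y \<odot> (x \<odot> z)) + (y \<odot> (z \<odot> x) - z \<odot> (y \<odot> x))
      + (z \<odot> (x \<odot> y) - x \<odot> (z \<odot> y)))"
    unfolding br_def commutator_def mul_diff_left mul_diff_right right by simp
  then show ?thesis
    unfolding left by simp
qed

text \<open>
  Both sides are \<open>(x(zt) - z(xt)) y\<close>: on the left after moving \<open>y\<close> inside by right commutativity,
  on the right after commuting the left multiplications by \<open>x\<close> and \<open>z\<close>.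
\<close>

lemma swap_left_entries:
  "(x \<odot> y) \<odot> (z \<odot> t) - (z \<odot> y) \<odot> (x \<odot> t) =
    \<delta> *s (((x \<odot> y) \<odot> z) \<odot> t) - \<delta> *s (((z \<odot> y) \<odot> x) \<odot> t)"
proof -
  have "(x \<odot> y) \<odot> (z \<odot> t) - (z \<odot> y) \<odot> (x \<odot> t) = (x \<odot> (z \<odot> t) - z \<odot> (x \<odot> t)) \<odot> y"
    by (simp add: mul_diff_left right_commutative[of _ y "_ \<odot> _"])
  also have "\<dots> = \<delta> *s (((x \<odot> z) \<odot> t) \<odot> y) - \<delta> *s (((z \<odot> x) \<odot> t) \<odot> y)"
    by (simp only: left_mul_commutator mul_diff_left mul_scale_left)
  also have "((x \<odot> z) \<odot> t) \<odot> y = ((x \<odot> y) \<odot> z) \<odot> t"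
    by (metis right_commutative)
  also have "((z \<odot> x) \<odot> t) \<odot> y = ((z \<odot> y) \<odot> x) \<odot> t"
    by (metis right_commutative)
  finally show ?thesis .
qed

text \<open>
  In \<open>(xy)(zt) - z((xy)t) = \<delta> ((xy)z)t - \<delta> (z(xy))t\<close> the terms \<open>z((xy)t)\<close> and \<open>((xy)z)t\<close> are
  symmetric in \<open>y, t\<close> and drop out when the identity is antisymmetrised; the remaining term
  \<open>(z(xy))t = (zt)(xy)\<close> again has the shape under study, with \<open>x\<close> and \<open>z\<close> exchanged.
\<close>

lemma swap_right_entries_twisted:
  "(x \<odot> y) \<odot> (z \<odot> t) - (x \<odot> t) \<odot> (z \<odot> y) =
    \<delta> *s ((z \<odot> y) \<odot> (x \<odot> t) - (z \<odot> t) \<odot> (x \<odot> y))"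
proof -
  have expand: "(x \<odot> a) \<odot> (z \<odot> b) =
      z \<odot> ((x \<odot> a) \<odot> b) + \<delta> *s (((x \<odot> a) \<odot> z) \<odot> b) - \<delta> *s ((z \<odot> b) \<odot> (x \<odot> a))" for a b
    using left_mul_commutator[of "x \<odot> a" z b] right_commutative[of z "x \<odot> a" b]
    by (simp add: algebra_simps)
  have "(x \<odot> y) \<odot> t = (x \<odot> t) \<odot> y" "((x \<odot> y) \<odot> z) \<odot> t = ((x \<odot> t) \<odot> z) \<odot> y"
    by (metis right_commutative)+
  then show ?thesis
    unfolding expand[of y t] expand[of t y] by (simp add: scale_right_diff_distrib)
qed

lemma swap_right_entries:
  assumes "\<delta> \<noteq> 1"
  shows "(x \<odot> y) \<odot> (z \<odot> t) = (x \<odot> t) \<odot> (z \<odot> y)"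
proof -
  define D where "D = (x \<odot> y) \<odot> (z \<odot> t) - (x \<odot> t) \<odot> (z \<odot> y)"
  have "((x \<odot> t) \<odot> z) \<odot> y = ((x \<odot> y) \<odot> z) \<odot> t" "((z \<odot> t) \<odot> x) \<odot> y = ((z \<odot> y) \<odot> x) \<odot> t"
    by (metis right_commutative)+
  then have "(x \<odot> y) \<odot> (z \<odot> t) - (z \<odot> y) \<odot> (x \<odot> t) = (x \<odot> t) \<odot> (z \<odot> y) - (z \<odot> t) \<odot> (x \<odot> y)"
    by (simp add: swap_left_entries)
  then have "D = (z \<odot> y) \<odot> (x \<odot> t) - (z \<odot> t) \<odot> (x \<odot> y)"
    unfolding D_def by (simp add: algebra_simps)
  then have "D = \<delta> *s D"
    using swap_right_entries_twisted[of x y z t] D_def by simp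
  then have "(1 - \<delta>) *s D = 0"
    by (simp add: scale_left_diff_distrib)
  with assms have "D = 0"
    by simp
  then show ?thesis
    unfolding D_def by simp
qed

text \<open>
  Once right entries may be exchanged, \<open>(zt)(xy) = (zy)(xt)\<close>, so the commutator of two products is
  an exchange of left entries.
\<close>

lemma commutator_of_products:
  assumes "\<delta> \<noteq> 1"
  shows "(x \<odot> y) \<odot> (z \<odot> t) - (z \<odot> t) \<odot> (x \<odot> y) =
    \<delta> *s (((x \<odot> y) \<odot> z) \<odot> t) - \<delta> *s (((z \<odot> y) \<odot> x) \<odot> t)"
  using swap_left_entries[of x y z t] swap_right_entries[OF assms, of z t x y] by simp

lemma commutator_metabelian:
  fixes x y z t :: 'n
  defines "br \<equiv> commutator mul"
  assumes "\<delta> \<noteq> 1"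
  shows "br (br x y) (br z t) = 0"
proof -
  define c where "c a b p q = (a \<odot> b) \<odot> (p \<odot> q) - (p \<odot> q) \<odot> (a \<odot> b)" for a b p q
  define w where "w a p q r = \<delta> *s (((a \<odot> p) \<odot> q) \<odot> r)" for a p q r
  have c_eq: "c a b p q = w a b p q - w p b a q" for a b p q
    unfolding c_def w_def by (rule commutator_of_products[OF assms(2)])
  have w_sym: "w a p q r = w a q p r" "w a p q r = w a p r q" for a p q r
    unfolding w_def by (metis right_commutative)+
  \<comment> \<open>Normal forms: the last three arguments of \<open>w\<close> in the order in which they occur in \<open>x, y, z, t\<close>.\<close>
  have w_normal: "w z y x t = w z x y t"
    "w x y t z = w x y z t" "w t y x z = w t x y z"
    "w y x t z = w y x z t"
    by (metis w_sym)+
  have "br (br x y) (br z t) = c x y z t - c y x z t - c x y t z + c y x t z"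
    unfolding br_def commutator_def c_def mul_diff_left mul_diff_right
    by (simp add: algebra_simps)
  also have "\<dots> = 0"
    unfolding c_eq w_normal by simp
  finally show ?thesis .
qed

end

theorem lemma31:
  fixes scale :: "'f::field_char_0 \<Rightarrow> 'n::ab_group_add \<Rightarrow> 'n"
    and mul :: "'n \<Rightarrow> 'n \<Rightarrow> 'n"
    and \<delta> :: 'f
  assumes "\<delta> \<noteq> 1"
    and "delta_novikov_algebra scale mul \<delta>"
  shows "metabelian_lie_algebra scale (commutator mul)"
proof -
  interpret delta_novikov_algebra scale mul \<delta>
    by (rule assms(2))
  interpret commutator: nonassoc_algebra scale "commutator mul"
    by (rule nonassoc_algebra_commutator)
  show ?thesis
  proof unfold_locales
    show "commutator mul x x = 0" for x
      by (simp add: commutator_def)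
  qed (use commutator_jacobi commutator_metabelian[OF assms(1)] in blast)+
qed

end
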